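(* Let $\mathcal{R}\subseteq\mathbb{R}_+^K$ be a closed convex region for which the quantities $C_{sym}(\mathcal{R})$, $C_{PF}(\mathcal{R})$, $C_{MM}(\mathcal{R})$ and $C_{sum}(\mathcal{R})$ defined in the context are well-defined. Then $$C_{sym}(\mathcal{R})\le C_{PF}(\mathcal{R})\le C_{sum}(\mathcal{R}),\qquad C_{sym}(\mathcal{R})\le C_{MM}(\mathcal{R})\le C_{sum}(\mathcal{R}).$$ Moreover, $C_{sym}(\mathcal{R})=C_{PF}(\mathcal{R})$ holds only if the proportional fair allocation is symmetric (all its components are equal).
   Context: $\mathbb{R}_+$ denotes the nonnegative reals. $C_{sym}(\mathcal{R})=\max\{Kr:\ (r,\dots,r)\in\mathcal{R}\}$. $C_{sum}(\mathcal{R})=\max_{\mathbf{r}\in\mathcal{R}}\sum_{i=1}^K r_i$. The proportional fair allocation $\mathbf{r}^{PF}$ is the point of $\mathcal{R}$ maximizing $\sum_{i=1}^K\log r_i$ (where $\mathcal{R}$ contains a point with all coordinates positive), and $C_{PF}(\mathcal{R})=\sum_{i=1}^K r_i^{PF}$. An allocation $\mathbf{r}^{MM}\in\mathcal{R}$ is max-min fair if for every $\mathbf{r}\in\mathcal{R}$ and every $i$ with $r_i>r_i^{MM}$ there is $j$ with $r_j<r_j^{MM}\le r_i^{MM}$; $C_{MM}(\mathcal{R})=\sum_{i=1}^K r_i^{MM}$ for the max-min fair allocation $\mathbf{r}^{MM}$. "Well-defined" means that the maxima are attained and the max-min fair allocation exists. *)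

theory Defs
  imports "HOL-Analysis.Analysis"
begin

text \<open>Regions of rate vectors are sets of type \<^typ>\<open>(real ^ 'n) set\<close>; the number of users $K$ is
  \<^term>\<open>CARD('n)\<close>.\<close>

definition attains_max :: "real set \<Rightarrow> bool" where
  "attains_max S \<longleftrightarrow> (\<exists>m\<in>S. \<forall>x\<in>S. x \<le> m)"

definition sum_rates :: "(real ^ 'n) set \<Rightarrow> real set" where
  "sum_rates R = {\<Sum>i\<in>UNIV. r $ i | r. r \<in> R}"

definition sym_rates :: "(real ^ 'n) set \<Rightarrow> real set" where
  "sym_rates R = {real CARD('n) * r | r. (\<chi> i. r) \<in> R}"

text \<open>\<^term>\<open>GREATEST x. x \<in> S\<close> is the maximum of \<^term>\<open>S\<close>, and is meaningful only under
  \<^term>\<open>attains_max S\<close>.\<close>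

definition C_sum :: "(real ^ 'n) set \<Rightarrow> real" where
  "C_sum R = (GREATEST c. c \<in> sum_rates R)"

definition C_sym :: "(real ^ 'n) set \<Rightarrow> real" where
  "C_sym R = (GREATEST c. c \<in> sym_rates R)"

text \<open>The library sets \<^prop>\<open>ln (0::real) = 0\<close>; the proportional fair objective needs the
  convention $\log 0 = -\infty$. Negative arguments do not occur for regions in the nonnegative
  orthant.\<close>

definition ext_log :: "real \<Rightarrow> ereal" where
  "ext_log x = (if 0 < x then ereal (ln x) else - \<infinity>)"

definition proportional_fair :: "(real ^ 'n) set \<Rightarrow> real ^ 'n \<Rightarrow> bool" where
  "proportional_fair R r \<longleftrightarrow> is_arg_max (\<lambda>s. \<Sum>i\<in>UNIV. ext_log (s $ i)) (\<lambda>s. s \<in> R) r"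

definition max_min_fair :: "(real ^ 'n) set \<Rightarrow> real ^ 'n \<Rightarrow> bool" where
  "max_min_fair R m \<longleftrightarrow>
     m \<in> R \<and>
     (\<forall>r\<in>R. \<forall>i. r $ i > m $ i \<longrightarrow> (\<exists>j. r $ j < m $ j \<and> m $ j \<le> m $ i))"

definition PF_allocation :: "(real ^ 'n) set \<Rightarrow> real ^ 'n" where
  "PF_allocation R = (THE r. proportional_fair R r)"

definition MM_allocation :: "(real ^ 'n) set \<Rightarrow> real ^ 'n" where
  "MM_allocation R = (THE r. max_min_fair R r)"

definition C_PF :: "(real ^ 'n) set \<Rightarrow> real" where
  "C_PF R = (\<Sum>i\<in>UNIV. PF_allocation R $ i)"

definition C_MM :: "(real ^ 'n) set \<Rightarrow> real" where
  "C_MM R = (\<Sum>i\<in>UNIV. MM_allocation R $ i)"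

end

theory Submission
  imports Defs
begin

text \<open>Optimality of the proportional fair point \<open>p\<close> along segments in \<open>R\<close> gives the first-order
  condition \<open>\<Sum>i. r\<^sub>i / p\<^sub>i \<le> K\<close> for all \<open>r \<in> R\<close>. Together with \<open>ln x \<le> x - 1\<close> it yields uniqueness
  of \<open>p\<close>. Applied to a symmetric point \<open>(c, \<dots>, c)\<close> and combined with
  \<open>0 \<le> (p\<^sub>i - c)\<^sup>2 / p\<^sub>i\<close>, it yields \<open>K * c \<le> \<Sum>i. p\<^sub>i\<close>, where equality forces \<open>p\<^sub>i = c\<close> for all \<open>i\<close>.
  For max-min fairness, every component of the fair point dominates \<open>c\<close>: exceeding a component
  would require some component of \<open>(c, \<dots>, c)\<close> to be smaller than \<open>c\<close>.\<close>

lemma attains_max_Greatest: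
  assumes "attains_max S"
  shows "(GREATEST c. c \<in> S) \<in> S" and "x \<in> S \<Longrightarrow> x \<le> (GREATEST c. c \<in> S)"
proof -
  obtain m where m: "m \<in> S" "\<And>x. x \<in> S \<Longrightarrow> x \<le> m"
    using assms by (auto simp: attains_max_def)
  then have "(GREATEST c. c \<in> S) = m"
    by (intro Greatest_equality) auto
  then show "(GREATEST c. c \<in> S) \<in> S" and "x \<in> S \<Longrightarrow> x \<le> (GREATEST c. c \<in> S)"
    using m by auto
qed

lemma sum_le_C_sum:
  assumes "attains_max (sum_rates R)" and "r \<in> R"
  shows "(\<Sum>i\<in>UNIV. r $ i) \<le> C_sum R"
  unfolding C_sum_def
  by (rule attains_max_Greatest(2)[OF assms(1)]) (use assms(2) in \<open>auto simp: sum_rates_def\<close>)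

lemma C_sym_attained:
  fixes R :: "(real ^ 'n) set"
  assumes "attains_max (sym_rates R)"
  obtains c where "(\<chi> i. c) \<in> R" and "C_sym R = real CARD('n) * c"
  using attains_max_Greatest(1)[OF assms] by (auto simp: sym_rates_def C_sym_def)

lemma sum_ext_log_pos:
  assumes "finite A" and "\<And>i. i \<in> A \<Longrightarrow> 0 < f i"
  shows "(\<Sum>i\<in>A. ext_log (f i)) = ereal (\<Sum>i\<in>A. ln (f i))"
proof -
  have "(\<Sum>i\<in>A. ext_log (f i)) = (\<Sum>i\<in>A. ereal (ln (f i)))"
    using assms by (intro sum.cong) (auto simp: ext_log_def)
  then show ?thesis by simp
qed

lemma sum_ext_log_nonpos:
  assumes "finite A" and "k \<in> A" and "f k \<le> 0"
  shows "(\<Sum>i\<in>A. ext_log (f i)) = - \<infinity>"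
proof -
  \<comment> \<open>In \<open>ereal\<close>, \<open>\<infinity> + - \<infinity>\<close> is
    \<open>\<infinity>\<close>, so the term at \<open>k\<close> forces the sum to
    \<open>- \<infinity>\<close> only once the rest is known not to be
    \<open>\<infinity>\<close>.\<close>
  have "(\<Sum>i\<in>A - {k}. ext_log (f i)) \<noteq> \<infinity>"
    using assms(1) by (auto simp: sum_Pinfty ext_log_def)
  then show ?thesis
    using assms by (subst sum.remove[of A k]) (auto simp: ext_log_def)
qed

text \<open>Leads from the \<open>ereal\<close> objective back to real logarithms: a positive point
  of \<open>R\<close> has a finite objective value, whereas one vanishing component would give
  \<open>p\<close> the value \<open>- \<infinity>\<close>.\<close>

lemma proportional_fairD:
  assumes "proportional_fair R p" and "\<exists>r\<in>R. \<forall>i. 0 < r $ i"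
  shows "p \<in> R" and "0 < p $ i"
    and "\<lbrakk>r \<in> R; \<And>i. 0 < r $ i\<rbrakk> \<Longrightarrow> (\<Sum>i\<in>UNIV. ln (r $ i)) \<le> (\<Sum>i\<in>UNIV. ln (p $ i))"
proof -
  show "p \<in> R"
    using assms(1) by (auto simp: proportional_fair_def is_arg_max_def)
  have max: "(\<Sum>i\<in>UNIV. ext_log (s $ i)) \<le> (\<Sum>i\<in>UNIV. ext_log (p $ i))" if "s \<in> R" for s
    using assms(1) that by (force simp: proportional_fair_def is_arg_max_def not_less)
  obtain q where q: "q \<in> R" "\<And>i. 0 < q $ i"
    using assms(2) by auto
  have pos: "0 < p $ i" for i
  proof (rule ccontr)
    assume "\<not> 0 < p $ i"
    then have "(\<Sum>i\<in>UNIV. ext_log (p $ i)) = - \<infinity>"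
      by (intro sum_ext_log_nonpos[of _ i]) auto
    then show False
      using max[OF q(1)] by (simp add: sum_ext_log_pos q(2))
  qed
  show "0 < p $ i" by (rule pos)
  show "(\<Sum>i\<in>UNIV. ln (r $ i)) \<le> (\<Sum>i\<in>UNIV. ln (p $ i))" if "r \<in> R" "\<And>i. 0 < r $ i"
    using max[OF that(1)] by (simp add: sum_ext_log_pos that(2) pos)
qed

lemma proportional_fair_first_order:
  fixes R :: "(real ^ 'n) set"
  assumes nonneg: "\<forall>r\<in>R. \<forall>i. 0 \<le> r $ i" and "convex R"
    and pf: "proportional_fair R p" and ex: "\<exists>r\<in>R. \<forall>i. 0 < r $ i"
    and r: "r \<in> R"
  shows "(\<Sum>i\<in>UNIV. r $ i / p $ i) \<le> real CARD('n)"
proof (rule ccontr)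
  note p = proportional_fairD[OF pf ex]
  \<comment> \<open>The objective along the segment from \<open>p\<close> to \<open>r\<close>. Its
    derivative at 0 is \<open>(\<Sum>i\<in>UNIV. r $ i / p $ i) - real CARD('n)\<close>, so a
    violated bound makes it increase just after 0.\<close>
  define g where "g t = (\<Sum>i\<in>UNIV. ln (p $ i + t * (r $ i - p $ i)))" for t
  assume "\<not> ?thesis"
  moreover have "(\<Sum>i\<in>UNIV. (r $ i - p $ i) / p $ i) = (\<Sum>i\<in>UNIV. r $ i / p $ i) - real CARD('n)"
    using p(2) by (simp add: diff_divide_distrib sum_subtractf less_imp_neq[symmetric])
  ultimately have "0 < (\<Sum>i\<in>UNIV. (r $ i - p $ i) / p $ i)"
    by simp
  moreover have "(g has_real_derivative (\<Sum>i\<in>UNIV. (r $ i - p $ i) / p $ i)) (at 0)"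
    unfolding g_def by (intro DERIV_sum) (auto intro!: derivative_eq_intros simp: p(2))
  ultimately obtain d where d: "0 < d" "\<And>h. \<lbrakk>0 < h; h < d\<rbrakk> \<Longrightarrow> g 0 < g (0 + h)"
    using DERIV_pos_inc_right by blast
  \<comment> \<open>Below \<open>d\<close> for the increase of \<open>g\<close>, and below 1 so that
    a positive share of \<open>p\<close> keeps the new point positive even where \<open>r\<close>
    vanishes.\<close>
  define t where "t = min (d / 2) (1 / 2)"
  have t: "0 < t" "t < d" "t < 1"
    using d(1) by (auto simp: t_def min_def)
  define s where "s = (1 - t) *\<^sub>R p + t *\<^sub>R r"
  have s: "s $ i = p $ i + t * (r $ i - p $ i)" for i
    by (simp add: s_def algebra_simps)
  have "s \<in> R"
    unfolding s_def using \<open>convex R\<close> p(1) r t by (intro convexD) auto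
  moreover have "0 < s $ i" for i
    using p(2)[of i] nonneg r t by (auto simp: s_def intro!: add_pos_nonneg)
  ultimately have "g t \<le> g 0"
    using p(3)[of s] by (simp add: g_def s)
  then show False
    using d(2)[OF t(1,2)] by simp
qed

lemma proportional_fair_unique:
  fixes R :: "(real ^ 'n) set"
  assumes nonneg: "\<forall>r\<in>R. \<forall>i. 0 \<le> r $ i" and "convex R" and ex: "\<exists>r\<in>R. \<forall>i. 0 < r $ i"
    and pf: "proportional_fair R p" and qf: "proportional_fair R q"
  shows "q = p"
proof -
  note p = proportional_fairD[OF pf ex] and q = proportional_fairD[OF qf ex]
  \<comment> \<open>The slack of \<open>ln x \<le> x - 1\<close> at the ratio
    \<open>q $ i / p $ i\<close>. The first-order condition and the optimality of \<open>q\<close>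
    bound the total slack by 0, and the slack vanishes only at ratio 1.\<close>
  define e where "e i = q $ i / p $ i - 1 - ln (q $ i / p $ i)" for i
  have e_nonneg: "0 \<le> e i" for i
    using ln_le_minus_one[of "q $ i / p $ i"] p(2)[of i] q(2)[of i] by (simp add: e_def)
  have "(\<Sum>i\<in>UNIV. ln (p $ i)) \<le> (\<Sum>i\<in>UNIV. ln (q $ i))"
    using q(3)[OF p(1,2)] .
  moreover have "(\<Sum>i\<in>UNIV. e i) = (\<Sum>i\<in>UNIV. q $ i / p $ i) - real CARD('n)
      - ((\<Sum>i\<in>UNIV. ln (q $ i)) - (\<Sum>i\<in>UNIV. ln (p $ i)))"
    using p(2) q(2) by (simp add: e_def ln_div sum_subtractf less_imp_neq[symmetric])
  ultimately have "(\<Sum>i\<in>UNIV. e i) \<le> 0"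
    using proportional_fair_first_order[OF nonneg \<open>convex R\<close> pf ex q(1)] by linarith
  then have "(\<Sum>i\<in>UNIV. e i) = 0"
    using e_nonneg by (intro antisym sum_nonneg) auto
  then have "e i = 0" for i
    using e_nonneg by (simp add: sum_nonneg_eq_0_iff)
  then have "q $ i / p $ i = 1" for i
    using p(2)[of i] q(2)[of i] by (intro ln_eq_minus_one) (auto simp: e_def)
  then show ?thesis
    using p(2) by (simp add: vec_eq_iff less_imp_neq[symmetric])
qed

text \<open>Uniqueness is what makes the \<open>THE\<close> in \<open>PF_allocation\<close> denote
  the assumed maximizer.\<close>

lemma proportional_fair_PF_allocation:
  assumes "\<forall>r\<in>R. \<forall>i. 0 \<le> r $ i" and "convex R" and "\<exists>r\<in>R. \<forall>i. 0 < r $ i"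
    and "\<exists>r. proportional_fair R r"
  shows "proportional_fair R (PF_allocation R)"
  unfolding PF_allocation_def
  using assms(4) by (auto intro: theI proportional_fair_unique[OF assms(1-3)])

lemma symmetric_le_proportional_fair:
  fixes R :: "(real ^ 'n) set"
  assumes nonneg: "\<forall>r\<in>R. \<forall>i. 0 \<le> r $ i" and "convex R" and ex: "\<exists>r\<in>R. \<forall>i. 0 < r $ i"
    and pf: "proportional_fair R p" and c: "(\<chi> i. c) \<in> R"
  shows "real CARD('n) * c \<le> (\<Sum>i\<in>UNIV. p $ i)"
    and "real CARD('n) * c = (\<Sum>i\<in>UNIV. p $ i) \<Longrightarrow> p $ i = c"
proof -
  note p = proportional_fairD[OF pf ex]
  define e where "e i = (p $ i - c)\<^sup>2 / p $ i" for i
  have e_nonneg: "0 \<le> e i" for i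
    using p(2)[of i] by (simp add: e_def)
  \<comment> \<open>The sign of \<open>c\<close> allows the first-order condition at the symmetric
    point to be multiplied by \<open>c\<close>; this bounds the last term in the expansion of the
    squares \<open>e i\<close>.\<close>
  have "0 \<le> c"
    using nonneg c by force
  moreover have "(\<Sum>i\<in>UNIV. c / p $ i) \<le> real CARD('n)"
    using proportional_fair_first_order[OF nonneg \<open>convex R\<close> pf ex c] by simp
  ultimately have "c * (\<Sum>i\<in>UNIV. c / p $ i) \<le> c * real CARD('n)"
    by (intro mult_left_mono)
  moreover have "e i = p $ i - 2 * c + c * (c / p $ i)" for i
    using p(2)[of i] by (simp add: e_def power2_eq_square field_simps)
  then have "(\<Sum>i\<in>UNIV. e i) = (\<Sum>i\<in>UNIV. p $ i) - real CARD('n) * (2 * c)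
      + c * (\<Sum>i\<in>UNIV. c / p $ i)"
    by (simp add: sum.distrib sum_subtractf sum_distrib_left)
  ultimately have le: "(\<Sum>i\<in>UNIV. e i) \<le> (\<Sum>i\<in>UNIV. p $ i) - real CARD('n) * c"
    by (simp add: algebra_simps)
  moreover have "0 \<le> (\<Sum>i\<in>UNIV. e i)"
    using e_nonneg by (intro sum_nonneg) auto
  ultimately show "real CARD('n) * c \<le> (\<Sum>i\<in>UNIV. p $ i)"
    by linarith
  assume "real CARD('n) * c = (\<Sum>i\<in>UNIV. p $ i)"
  with le \<open>0 \<le> (\<Sum>i\<in>UNIV. e i)\<close> have "(\<Sum>i\<in>UNIV. e i) = 0"
    by linarith
  then have "e i = 0"
    using e_nonneg by (simp add: sum_nonneg_eq_0_iff)
  then show "p $ i = c"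
    using p(2)[of i] by (simp add: e_def)
qed

text \<open>Among the components where the two points differ, take one whose smaller value
  \<open>f i\<close> is least. Fairness of the point that is smaller there yields another differing
  component with a still smaller value.\<close>

lemma max_min_fair_unique:
  fixes R :: "(real ^ 'n) set"
  assumes m: "max_min_fair R m" and m': "max_min_fair R m'"
  shows "m = m'"
proof (rule ccontr)
  assume "m \<noteq> m'"
  define D where "D = {i. m $ i \<noteq> m' $ i}"
  define f where "f i = min (m $ i) (m' $ i)" for i
  have "D \<noteq> {}"
    using \<open>m \<noteq> m'\<close> by (auto simp: D_def vec_eq_iff)
  then obtain i where i: "i \<in> D" "\<And>j. j \<in> D \<Longrightarrow> f i \<le> f j"
    using arg_min_if_finite[of D f] by (metis finite not_le)
  \<comment> \<open>Stated for \<open>u\<close> and \<open>v\<close> in either order, so that it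
    serves both cases below.\<close>
  have no_smaller: False if "u $ j < v $ j" "v $ j \<le> f i" "{u, v} = {m, m'}" for u v :: "real ^ 'n" and j
  proof -
    have "j \<in> D" "f j = u $ j"
      using that by (auto simp: D_def f_def doubleton_eq_iff)
    then show False
      using i(2)[of j] that by simp
  qed
  consider "m $ i < m' $ i" | "m' $ i < m $ i"
    using i(1) by (auto simp: D_def neq_iff)
  then show False
  proof cases
    case 1
    then obtain j where "m' $ j < m $ j" "m $ j \<le> m $ i"
      using m m' unfolding max_min_fair_def by blast
    then show False
      using no_smaller[of m' j m] 1 by (auto simp: f_def)
  next
    case 2
    then obtain j where "m $ j < m' $ j" "m' $ j \<le> m' $ i"
      using m m' unfolding max_min_fair_def by blast
    then show False
      using no_smaller[of m j m'] 2 by (auto simp: f_def)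
  qed
qed

lemma max_min_fair_MM_allocation:
  assumes "\<exists>r. max_min_fair R r"
  shows "max_min_fair R (MM_allocation R)"
  unfolding MM_allocation_def using assms by (auto intro: theI max_min_fair_unique)

lemma symmetric_le_max_min_fair:
  assumes m: "max_min_fair R m" and c: "(\<chi> i. c) \<in> R"
  shows "c \<le> m $ i"
proof (rule ccontr)
  assume less: "\<not> c \<le> m $ i"
  then have "(\<chi> i. c) $ i > m $ i"
    by simp
  then obtain j where "(\<chi> i. c) $ j < m $ j" "m $ j \<le> m $ i"
    using m c unfolding max_min_fair_def by blast
  then show False
    using less by simp
qed

theorem theorem3:
  fixes R :: "(real ^ 'n) set"
  assumes nonneg: "\<forall>r\<in>R. \<forall>i. 0 \<le> r $ i"
    and "closed R"
    and "convex R"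
    and "\<exists>r\<in>R. \<forall>i. 0 < r $ i"
    and "attains_max (sym_rates R)"
    and "attains_max (sum_rates R)"
    and "\<exists>r. proportional_fair R r"
    and "\<exists>r. max_min_fair R r"
  shows "C_sym R \<le> C_PF R \<and> C_PF R \<le> C_sum R \<and>
         C_sym R \<le> C_MM R \<and> C_MM R \<le> C_sum R \<and>
         (C_sym R = C_PF R \<longrightarrow> (\<forall>i j. PF_allocation R $ i = PF_allocation R $ j))"
proof -
  obtain c where c: "(\<chi> i. c) \<in> R" "C_sym R = real CARD('n) * c"
    using C_sym_attained assms(5) .
  have pf: "proportional_fair R (PF_allocation R)"
    by (rule proportional_fair_PF_allocation) fact+
  have mm: "max_min_fair R (MM_allocation R)"
    by (rule max_min_fair_MM_allocation) fact
  note sym_pf = symmetric_le_proportional_fair[OF nonneg assms(3,4) pf c(1)]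
  have "C_sym R \<le> C_PF R"
    using sym_pf(1) by (simp add: c(2) C_PF_def)
  moreover have "C_PF R \<le> C_sum R"
    unfolding C_PF_def using sum_le_C_sum assms(6) proportional_fairD(1)[OF pf assms(4)] .
  moreover have "C_sym R \<le> C_MM R"
    using sum_mono[of UNIV "\<lambda>i. c" "\<lambda>i. MM_allocation R $ i"] symmetric_le_max_min_fair[OF mm c(1)]
    by (simp add: c(2) C_MM_def)
  moreover have "C_MM R \<le> C_sum R"
    using sum_le_C_sum[OF assms(6)] mm by (simp add: C_MM_def max_min_fair_def)
  moreover have "PF_allocation R $ i = PF_allocation R $ j" if "C_sym R = C_PF R" for i j
    using that sym_pf(2) by (simp add: c(2) C_PF_def)
  ultimately show ?thesis
    by blast
qed

end
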